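(* Let $\phi$ be an arbitrary 1-block code from a shift space $X$ onto a shift space $Y$, and let $a$ be a symbol belonging neither to the alphabet of $X$ nor to the alphabet of $Y$. For a point $z$ of $X$ or of $Y$, define $\eta(z)$ by $\eta(z)_{2i}=z_i$ and $\eta(z)_{2i+1}=a$ for all $i\in\mathbb{Z}$. Let $\sqrt{X}=\{\eta(x),\sigma(\eta(x)) : x\in X\}$ and $\sqrt{Y}=\{\eta(y),\sigma(\eta(y)) : y\in Y\}$, and let $\sqrt{\phi}$ be the 1-block code from $\sqrt{X}$ onto $\sqrt{Y}$ given on symbols $c\in\mathcal{B}_1(\sqrt{X})$ by $\sqrt{\phi}(c)=a$ if $c=a$ and $\sqrt{\phi}(c)=\phi(c)$ if $c\ne a$. Then $\sqrt{\phi}$ is right eresolving, and if $\phi$ is not right continuing, then $\sqrt{\phi}$ is not right continuing. Consequently, right eresolving codes between shift spaces are not necessarily right continuing: there exist shift spaces and a right eresolving 1-block code from one onto the other that is not right continuing.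
   Context: A shift space over a finite alphabet $A$ is a closed shift-invariant subset of $A^{\mathbb{Z}}$; $\sigma$ denotes the shift map, $(\sigma x)_i=x_{i+1}$. $\mathcal{B}_n(X)$ is the set of words of length $n$ appearing in points of $X$; the alphabet of a shift space is identified with its set of appearing symbols $\mathcal{B}_1(X)$. A block code between shift spaces is a continuous shift-commuting map; it is a 1-block code if $(\phi(x))_0$ is determined by $x_0$, in which case $\phi$ also denotes the induced map on symbols. A 1-block code $\phi$ from $X$ onto $Y$ is right eresolving if for all $a_0\in\mathcal{B}_1(X)$ and $b_0b_1\in\mathcal{B}_2(Y)$ with $\phi(a_0)=b_0$, there is at least one symbol $a_1$ with $a_0a_1\in\mathcal{B}_2(X)$ and $\phi(a_1)=b_1$. Two points $x,x'$ are left asymptotic if there is $n\in\mathbb{Z}$ with $x_i=x'_i$ for all $i\le n$. A block code $\phi$ from $X$ onto $Y$ is right continuing if for each $x\in X$ and $y\in Y$ such that $\phi(x)$ is left asymptotic to $y$, there is at least one $\bar x\in X$ that is left asymptotic to $x$ with $\phi(\bar x)=y$. *)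

theory Defs
  imports "HOL-Analysis.Analysis"
begin

definition shift :: "(int \<Rightarrow> 's) \<Rightarrow> int \<Rightarrow> 's" where
  "shift x = (\<lambda>i. x (i + 1))"

definition full_shift :: "'s set \<Rightarrow> (int \<Rightarrow> 's) topology" where
  "full_shift A = product_topology (\<lambda>_. discrete_topology A) UNIV"

definition shift_space :: "(int \<Rightarrow> 's) set \<Rightarrow> bool" where
  "shift_space X \<longleftrightarrow> (\<exists>A. finite A \<and> closedin (full_shift A) X) \<and> shift ` X = X"

definition blocks :: "nat \<Rightarrow> (int \<Rightarrow> 's) set \<Rightarrow> 's list set" where
  "blocks n X = {w. length w = n \<and> (\<exists>x\<in>X. \<exists>i. \<forall>k<n. w ! k = x (i + int k))}"

definition symbols :: "(int \<Rightarrow> 's) set \<Rightarrow> 's set" where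
  "symbols X = {c. [c] \<in> blocks 1 X}"

text \<open>A shift space carries the topology induced from the full shift over its own symbols;
  any larger alphabet induces the same topology.\<close>

definition block_code ::
  "(int \<Rightarrow> 's) set \<Rightarrow> (int \<Rightarrow> 't) set \<Rightarrow> ((int \<Rightarrow> 's) \<Rightarrow> int \<Rightarrow> 't) \<Rightarrow> bool" where
  "block_code X Y \<phi> \<longleftrightarrow> shift_space X \<and> shift_space Y \<and>
     continuous_map (subtopology (full_shift (symbols X)) X)
                    (subtopology (full_shift (symbols Y)) Y) \<phi> \<and>
     (\<forall>x\<in>X. \<phi> (shift x) = shift (\<phi> x))"

definition one_block_code ::
  "(int \<Rightarrow> 's) set \<Rightarrow> (int \<Rightarrow> 't) set \<Rightarrow> ((int \<Rightarrow> 's) \<Rightarrow> int \<Rightarrow> 't) \<Rightarrow> bool" where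
  "one_block_code X Y \<phi> \<longleftrightarrow> block_code X Y \<phi> \<and>
     (\<forall>x\<in>X. \<forall>x'\<in>X. x 0 = x' 0 \<longrightarrow> \<phi> x 0 = \<phi> x' 0)"

text \<open>The map on symbols induced by a 1-block code; meaningful only on \<open>symbols X\<close>.\<close>

definition symbol_map ::
  "(int \<Rightarrow> 's) set \<Rightarrow> ((int \<Rightarrow> 's) \<Rightarrow> int \<Rightarrow> 't) \<Rightarrow> 's \<Rightarrow> 't" where
  "symbol_map X \<phi> c = (THE b. \<exists>x\<in>X. x 0 = c \<and> \<phi> x 0 = b)"

definition right_eresolving ::
  "(int \<Rightarrow> 's) set \<Rightarrow> (int \<Rightarrow> 't) set \<Rightarrow> ((int \<Rightarrow> 's) \<Rightarrow> int \<Rightarrow> 't) \<Rightarrow> bool" where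
  "right_eresolving X Y \<phi> \<longleftrightarrow> one_block_code X Y \<phi> \<and> \<phi> ` X = Y \<and>
     (\<forall>a0 b0 b1. a0 \<in> symbols X \<and> [b0, b1] \<in> blocks 2 Y \<and> symbol_map X \<phi> a0 = b0 \<longrightarrow>
        (\<exists>a1. [a0, a1] \<in> blocks 2 X \<and> symbol_map X \<phi> a1 = b1))"

definition left_asymptotic :: "(int \<Rightarrow> 's) \<Rightarrow> (int \<Rightarrow> 's) \<Rightarrow> bool" where
  "left_asymptotic x x' \<longleftrightarrow> (\<exists>n. \<forall>i\<le>n. x i = x' i)"

definition right_continuing ::
  "(int \<Rightarrow> 's) set \<Rightarrow> (int \<Rightarrow> 't) set \<Rightarrow> ((int \<Rightarrow> 's) \<Rightarrow> int \<Rightarrow> 't) \<Rightarrow> bool" where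
  "right_continuing X Y \<phi> \<longleftrightarrow> block_code X Y \<phi> \<and> \<phi> ` X = Y \<and>
     (\<forall>x\<in>X. \<forall>y\<in>Y. left_asymptotic (\<phi> x) y \<longrightarrow>
        (\<exists>x'\<in>X. left_asymptotic x' x \<and> \<phi> x' = y))"

definition eta :: "'s \<Rightarrow> (int \<Rightarrow> 's) \<Rightarrow> int \<Rightarrow> 's" where
  "eta a z = (\<lambda>i. if even i then z (i div 2) else a)"

definition sqrt_shift :: "'s \<Rightarrow> (int \<Rightarrow> 's) set \<Rightarrow> (int \<Rightarrow> 's) set" where
  "sqrt_shift a X = (\<Union>x\<in>X. {eta a x, shift (eta a x)})"

definition sqrt_code ::
  "'s \<Rightarrow> (int \<Rightarrow> 's) set \<Rightarrow> ((int \<Rightarrow> 's) \<Rightarrow> int \<Rightarrow> 's) \<Rightarrow> (int \<Rightarrow> 's) \<Rightarrow> int \<Rightarrow> 's" where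
  "sqrt_code a X \<phi> z = (\<lambda>i. if z i = a then a else symbol_map X \<phi> (z i))"

end

theory Submission imports Defs begin

text \<open>
  In a point of \<open>sqrt_shift a X\<close> genuine symbols alternate with the separator \<open>a\<close>. A word of length
  two therefore contains at most one genuine symbol, and the local lifting property demanded of a
  right eresolving code has nothing to remember: after a genuine symbol the only continuation is
  \<open>a\<close>, which lifts to \<open>a\<close>; after \<open>a\<close> the next symbol of \<open>Y\<close> may be lifted to any of its preimages,
  because \<open>a\<close> can be followed by every symbol of \<open>X\<close>. Thus \<open>sqrt_code a X \<phi>\<close> is always right
  eresolving (\<open>right_eresolving_sqrt\<close>).

  Right continuation, on the other hand, speaks of whole points, and interleaving with \<open>a\<close> loses
  nothing there: \<open>eta a\<close> intertwines \<open>\<phi>\<close> with \<open>sqrt_code a X \<phi>\<close>, it preserves and reflects left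
  asymptoticity, and the positions of \<open>a\<close> in \<open>eta a y\<close> force each preimage of \<open>eta a y\<close> to have the
  form \<open>eta a x\<close> (\<open>sqrt_code_eq_eta_imp\<close>). So right continuation of the square root descends to
  \<open>\<phi>\<close> (\<open>right_continuing_of_sqrt\<close>).

  It remains to exhibit one code that is not right continuing. Let \<open>Y\<close> consist of the points over
  \<open>{0, 1}\<close> in which \<open>0\<close> never follows \<open>1\<close>; let \<open>X\<close> be a copy of \<open>Y\<close> with \<open>2\<close> in place of \<open>0\<close>,
  together with the isolated fixed point \<open>0\<close>, and let \<open>\<phi>\<close> merge \<open>2\<close> into \<open>0\<close>. The fixed point
  maps to a point left asymptotic to \<open>...0001111...\<close>, yet no other point of \<open>X\<close> is left
  asymptotic to it. The square root of this code is the required counterexample.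
\<close>

section \<open>Words, symbols and translations\<close>

lemma mem_symbols_iff: "c \<in> symbols X \<longleftrightarrow> (\<exists>x\<in>X. \<exists>i. x i = c)"
  by (auto simp: symbols_def blocks_def)

lemma symbolsI: "x \<in> X \<Longrightarrow> x i \<in> symbols X"
  by (auto simp: mem_symbols_iff)

lemma mem_blocks_2_iff:
  "[b, c] \<in> blocks 2 X \<longleftrightarrow> (\<exists>x\<in>X. \<exists>i. x i = b \<and> x (i + 1) = c)"
proof -
  have "(\<forall>k<2. [b, c] ! k = x (i + int k)) \<longleftrightarrow> x i = b \<and> x (i + 1) = c"
    for x :: "int \<Rightarrow> 'a" and i
    by (auto simp: less_2_cases_iff)
  then show ?thesis by (auto simp: blocks_def)
qed

lemma shift_spaceI:
  assumes "finite A" "closedin (full_shift A) X" "shift ` X = X"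
  shows "shift_space X"
  using assms by (auto simp: shift_space_def)

lemma topspace_full_shift: "topspace (full_shift A) = {x. \<forall>i. x i \<in> A}"
  by (auto simp: full_shift_def PiE_def Pi_def)

lemma translate_mem:
  assumes "shift_space X" "x \<in> X"
  shows "(\<lambda>i. x (i + k)) \<in> X"
proof -
  have inv: "shift ` X = X" using assms(1) by (simp add: shift_space_def)
  show ?thesis
  proof (induction k rule: int_induct [where k = 0])
    case base
    then show ?case using assms(2) by simp
  next
    case (step1 k)
    then have "shift (\<lambda>i. x (i + k)) \<in> X" using inv by blast
    then show ?case by (simp add: shift_def algebra_simps)
  next
    case (step2 k)
    then obtain u where u: "u \<in> X" "(\<lambda>i. x (i + k)) = shift u" using inv by blast
    have "u i = x (i + (k - 1))" for i
      using fun_cong [OF u(2), of "i - 1"] by (simp add: shift_def algebra_simps)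
    then have "u = (\<lambda>i. x (i + (k - 1)))" by blast
    with u(1) show ?case by simp
  qed
qed

lemma block_code_translate:
  assumes "block_code X Y \<phi>" "x \<in> X"
  shows "\<phi> (\<lambda>i. x (i + k)) = (\<lambda>i. \<phi> x (i + k))"
proof -
  have sp: "shift_space X" and com: "\<And>x. x \<in> X \<Longrightarrow> \<phi> (shift x) = shift (\<phi> x)"
    using assms(1) by (auto simp: block_code_def)
  have step: "\<phi> (\<lambda>i. x (i + (k + 1))) = shift (\<phi> (\<lambda>i. x (i + k)))" for k
    using com [OF translate_mem [OF sp assms(2), of k]] by (simp add: shift_def algebra_simps)
  show ?thesis
  proof (induction k rule: int_induct [where k = 0])
    case base
    then show ?case by simp
  next
    case (step1 k)
    then show ?case using step [of k] by (simp add: shift_def algebra_simps)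
  next
    case (step2 k)
    then have eq: "shift (\<phi> (\<lambda>i. x (i + (k - 1)))) = (\<lambda>i. \<phi> x (i + k))"
      using step [of "k - 1"] by simp
    show ?case
    proof
      fix i
      show "\<phi> (\<lambda>i. x (i + (k - 1))) i = \<phi> x (i + (k - 1))"
        using fun_cong [OF eq, of "i - 1"] by (simp add: shift_def algebra_simps)
    qed
  qed
qed

section \<open>One-block codes as letter-to-letter maps\<close>

lemma symbol_map_zero:
  assumes "one_block_code X Y \<phi>" "x \<in> X"
  shows "symbol_map X \<phi> (x 0) = \<phi> x 0"
  unfolding symbol_map_def
proof (rule the_equality)
  show "\<exists>x'\<in>X. x' 0 = x 0 \<and> \<phi> x' 0 = \<phi> x 0" using assms(2) by blast
  show "b = \<phi> x 0" if "\<exists>x'\<in>X. x' 0 = x 0 \<and> \<phi> x' 0 = b" for b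
    using that assms unfolding one_block_code_def by metis
qed

text \<open>The induced symbol map is defined by looking at coordinate \<open>0\<close>; since the code commutes with
  all translations, it governs every coordinate.\<close>

lemma one_block_code_apply:
  assumes "one_block_code X Y \<phi>" "x \<in> X"
  shows "\<phi> x i = symbol_map X \<phi> (x i)"
proof -
  have bc: "block_code X Y \<phi>" using assms(1) by (simp add: one_block_code_def)
  then have "(\<lambda>j. x (j + i)) \<in> X"
    using translate_mem assms(2) by (auto simp: block_code_def)
  from symbol_map_zero [OF assms(1) this] show ?thesis
    by (simp add: block_code_translate [OF bc assms(2)])
qed

lemma letter_map_one_block_code:
  assumes "shift_space X" "shift_space Y" and maps: "\<And>x. x \<in> X \<Longrightarrow> (\<lambda>i. g (x i)) \<in> Y"
  shows "one_block_code X Y (\<lambda>x i. g (x i))"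
proof -
  let ?TX = "subtopology (full_shift (symbols X)) X"
  have g: "g \<in> symbols X \<rightarrow> symbols Y"
    using maps by (fastforce simp: mem_symbols_iff)
  have "continuous_map ?TX (discrete_topology (symbols X)) (\<lambda>x. x i)" for i
    unfolding full_shift_def
    by (rule continuous_map_from_subtopology)
      (auto intro: continuous_map_product_projection)
  moreover have "continuous_map (discrete_topology (symbols X)) (discrete_topology (symbols Y)) g"
    using g by auto
  ultimately have "continuous_map ?TX (discrete_topology (symbols Y)) (\<lambda>x. g (x i))" for i
    using continuous_map_compose [unfolded comp_def] by blast
  then have "continuous_map ?TX (full_shift (symbols Y)) (\<lambda>x i. g (x i))"
    unfolding full_shift_def by (simp add: continuous_map_componentwise_UNIV)
  then have "continuous_map ?TX (subtopology (full_shift (symbols Y)) Y) (\<lambda>x i. g (x i))"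
    using maps by (auto simp: continuous_map_in_subtopology)
  then show ?thesis
    using assms by (auto simp: one_block_code_def block_code_def shift_def)
qed

lemma symbol_map_letter_map:
  assumes "shift_space X" "c \<in> symbols X"
  shows "symbol_map X (\<lambda>x i. g (x i)) c = g c"
  unfolding symbol_map_def
proof (rule the_equality)
  obtain x i where x: "x \<in> X" "x i = c" using assms(2) by (auto simp: mem_symbols_iff)
  show "\<exists>x\<in>X. x 0 = c \<and> g (x 0) = g c"
    using x(2) by (intro bexI [OF _ translate_mem [OF assms(1) x(1), of i]]) simp
qed auto

section \<open>The square root of a shift space\<close>

lemma eta_even [simp]: "eta a x (2 * i) = x i"
  and eta_odd [simp]: "eta a x (2 * i + 1) = a"
  by (auto simp: eta_def)

lemma shift_shift_eta: "shift (shift (eta a x)) = eta a (shift x)"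
  by (auto simp: shift_def eta_def fun_eq_iff add.assoc)

lemma inj_eta: "eta a x = eta a y \<longleftrightarrow> x = y"
proof
  assume eq: "eta a x = eta a y"
  show "x = y"
  proof
    fix i
    show "x i = y i" using fun_cong [OF eq, of "2 * i"] by simp
  qed
qed simp

lemma left_asymptotic_eta: "left_asymptotic (eta a x) (eta a y) \<longleftrightarrow> left_asymptotic x y"
proof
  assume "left_asymptotic (eta a x) (eta a y)"
  then obtain n where n: "\<And>i. i \<le> n \<Longrightarrow> eta a x i = eta a y i"
    by (auto simp: left_asymptotic_def)
  have "x i = y i" if "i \<le> n div 2" for i
    using n [of "2 * i"] that by simp
  then show "left_asymptotic x y" by (auto simp: left_asymptotic_def)
next
  assume "left_asymptotic x y"
  then obtain n where n: "\<And>i. i \<le> n \<Longrightarrow> x i = y i" by (auto simp: left_asymptotic_def)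
  have "eta a x i = eta a y i" if "i \<le> 2 * n" for i
    using n [of "i div 2"] that by (auto simp: eta_def)
  then show "left_asymptotic (eta a x) (eta a y)" by (auto simp: left_asymptotic_def)
qed

lemma symbols_sqrt_shift_subset: "symbols (sqrt_shift a X) \<subseteq> insert a (symbols X)"
proof
  fix c assume "c \<in> symbols (sqrt_shift a X)"
  then obtain x i where x: "x \<in> X" "c = eta a x i \<or> c = eta a x (i + 1)"
    by (auto simp: mem_symbols_iff sqrt_shift_def shift_def)
  have "eta a x j \<in> insert a (symbols X)" for j
    using x(1) by (simp add: eta_def symbolsI)
  with x(2) show "c \<in> insert a (symbols X)" by metis
qed

text \<open>Full shifts over finite alphabets are compact Hausdorff spaces, so continuous images of
  closed sets are closed; this gives closedness of a square root without describing it by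
  conditions on coordinates.\<close>

lemma closedin_full_shift_image:
  assumes "finite A" "closedin (full_shift A) X"
    and "continuous_map (full_shift A) (full_shift B) f"
  shows "closedin (full_shift B) (f ` X)"
proof -
  have "compact_space (full_shift A)"
    using assms(1) by (simp add: full_shift_def compact_space_product_topology
        compact_space_discrete_topology)
  then have "compactin (full_shift A) X"
    using assms(2) by (rule closedin_compact_space)
  then have "compactin (full_shift B) (f ` X)"
    using assms(3) by (rule image_compactin)
  moreover have "Hausdorff_space (full_shift B)"
    by (simp add: full_shift_def Hausdorff_space_product_topology)
  ultimately show ?thesis by (metis compactin_imp_closedin)
qed

lemma continuous_map_eta: "continuous_map (full_shift A) (full_shift (insert a A)) (eta a)"
proof -
  have "continuous_map (full_shift A) (discrete_topology (insert a A)) (\<lambda>x. eta a x i)" for i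
  proof (cases "even i")
    case True
    have "continuous_map (full_shift A) (discrete_topology A) (\<lambda>x. x (i div 2))"
      unfolding full_shift_def by (auto intro: continuous_map_product_projection)
    moreover have "continuous_map (discrete_topology A) (discrete_topology (insert a A)) (\<lambda>c. c)"
      by auto
    ultimately have "continuous_map (full_shift A) (discrete_topology (insert a A)) (\<lambda>x. x (i div 2))"
      by (rule continuous_map_compose [unfolded comp_def])
    then show ?thesis using True by (simp add: eta_def)
  qed (simp add: eta_def)
  then show ?thesis
    unfolding full_shift_def [of "insert a A"] by (simp add: continuous_map_componentwise_UNIV)
qed

lemma continuous_map_shift: "continuous_map (full_shift A) (full_shift A) shift"
  unfolding full_shift_def shift_def
  by (auto simp: continuous_map_componentwise_UNIV intro: continuous_map_product_projection)

lemma shift_space_sqrt_shift: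
  assumes "shift_space X"
  shows "shift_space (sqrt_shift a X)"
proof -
  obtain A where A: "finite A" "closedin (full_shift A) X" and inv: "shift ` X = X"
    using assms by (auto simp: shift_space_def)
  have split: "sqrt_shift a X = eta a ` X \<union> shift ` eta a ` X"
    by (auto simp: sqrt_shift_def)
  have cl: "closedin (full_shift (insert a A)) (eta a ` X)"
    by (rule closedin_full_shift_image [OF A continuous_map_eta])
  moreover have "closedin (full_shift (insert a A)) (shift ` eta a ` X)"
    using A(1) by (intro closedin_full_shift_image [OF _ cl continuous_map_shift]) simp
  ultimately have "closedin (full_shift (insert a A)) (sqrt_shift a X)"
    unfolding split by (rule closedin_Un)
  moreover have "shift ` shift ` eta a ` X = eta a ` shift ` X"
    by (simp add: image_image shift_shift_eta)
  then have "shift ` sqrt_shift a X = sqrt_shift a X"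
    by (simp add: split image_Un inv Un_commute)
  ultimately show ?thesis using A(1) by (intro shift_spaceI [of "insert a A"]) auto
qed

lemma separator_then_symbol:
  assumes "c \<in> symbols X"
  shows "[a, c] \<in> blocks 2 (sqrt_shift a X)"
proof -
  obtain x i where x: "x \<in> X" "x i = c" using assms by (auto simp: mem_symbols_iff)
  have "eta a x (2 * i - 1) = a" "eta a x (2 * i - 1 + 1) = c"
    using x(2) by (simp_all add: eta_def)
  moreover have "eta a x \<in> sqrt_shift a X" using x(1) by (auto simp: sqrt_shift_def)
  ultimately show ?thesis unfolding mem_blocks_2_iff by blast
qed

lemma symbol_then_separator:
  assumes "c \<in> symbols X"
  shows "[c, a] \<in> blocks 2 (sqrt_shift a X)"
proof -
  obtain x i where x: "x \<in> X" "x i = c" using assms by (auto simp: mem_symbols_iff)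
  then have "eta a x (2 * i) = c" "eta a x (2 * i + 1) = a" by simp_all
  moreover have "eta a x \<in> sqrt_shift a X" using x(1) by (auto simp: sqrt_shift_def)
  ultimately show ?thesis unfolding mem_blocks_2_iff by blast
qed

lemma blocks_2_sqrt_shift_cases:
  assumes "[b, c] \<in> blocks 2 (sqrt_shift a X)"
  obtains "b = a" "c \<in> symbols X" | "b \<in> symbols X" "c = a"
proof -
  obtain x i where x: "x \<in> X" "b = eta a x i" "c = eta a x (i + 1)"
    using assms by (auto simp: mem_blocks_2_iff sqrt_shift_def shift_def)
  then have "b = a \<and> c \<in> symbols X \<or> b \<in> symbols X \<and> c = a"
    by (cases "even i") (simp_all add: eta_def symbolsI)
  then show ?thesis using that by blast
qed

section \<open>The square root of a one-block code\<close>

context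
  fixes X Y :: "(int \<Rightarrow> 's) set" and \<phi> :: "(int \<Rightarrow> 's) \<Rightarrow> int \<Rightarrow> 's" and a :: 's
  assumes code: "one_block_code X Y \<phi>" and onto: "\<phi> ` X = Y"
    and a_X: "a \<notin> symbols X" and a_Y: "a \<notin> symbols Y"
begin

lemma shift_spaces: "shift_space X" "shift_space Y"
  using code by (auto simp: one_block_code_def block_code_def)

lemma sqrt_code_eta:
  assumes "x \<in> X"
  shows "sqrt_code a X \<phi> (eta a x) = eta a (\<phi> x)"
proof
  fix i
  have "x (i div 2) \<noteq> a" using symbolsI [OF assms] a_X by metis
  then show "sqrt_code a X \<phi> (eta a x) i = eta a (\<phi> x) i"
    by (simp add: sqrt_code_def eta_def one_block_code_apply [OF code assms])
qed

lemma sqrt_code_shift: "sqrt_code a X \<phi> (shift z) = shift (sqrt_code a X \<phi> z)"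
  by (simp add: sqrt_code_def shift_def)

lemma sqrt_code_onto: "sqrt_code a X \<phi> ` sqrt_shift a X = sqrt_shift a Y"
  unfolding sqrt_shift_def onto [symmetric]
  by (simp add: image_UN sqrt_code_eta sqrt_code_shift cong: SUP_cong)

lemma sqrt_code_letter_map:
  "sqrt_code a X \<phi> = (\<lambda>z i. (\<lambda>c. if c = a then a else symbol_map X \<phi> c) (z i))"
  by (simp add: sqrt_code_def fun_eq_iff)

lemma one_block_code_sqrt:
  "one_block_code (sqrt_shift a X) (sqrt_shift a Y) (sqrt_code a X \<phi>)"
  unfolding sqrt_code_letter_map
proof (rule letter_map_one_block_code)
  show "(\<lambda>i. if z i = a then a else symbol_map X \<phi> (z i)) \<in> sqrt_shift a Y"
    if "z \<in> sqrt_shift a X" for z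
    using that sqrt_code_onto unfolding sqrt_code_def by blast
qed (auto intro: shift_space_sqrt_shift shift_spaces)

lemma symbol_map_sqrt:
  assumes "c \<in> symbols (sqrt_shift a X)"
  shows "symbol_map (sqrt_shift a X) (sqrt_code a X \<phi>) c = (if c = a then a else symbol_map X \<phi> c)"
  unfolding sqrt_code_letter_map
  by (rule symbol_map_letter_map [OF shift_space_sqrt_shift [OF shift_spaces(1)] assms])

lemma symbol_map_surj:
  assumes "d \<in> symbols Y"
  obtains c where "c \<in> symbols X" "symbol_map X \<phi> c = d"
proof -
  obtain x i where "x \<in> X" "\<phi> x i = d"
    using assms by (auto simp: mem_symbols_iff onto [symmetric])
  then show ?thesis
    using one_block_code_apply [OF code, of x i] by (intro that [of "x i"]) (simp_all add: symbolsI)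
qed

lemma symbol_map_mem:
  assumes "c \<in> symbols X"
  shows "symbol_map X \<phi> c \<in> symbols Y"
proof -
  obtain x i where x: "x \<in> X" "x i = c" using assms by (auto simp: mem_symbols_iff)
  have "\<phi> x i \<in> symbols Y" using x(1) onto by (intro symbolsI) auto
  then show ?thesis using x one_block_code_apply [OF code, of x i] by simp
qed

text \<open>One symbol of each two-symbol word is the separator, whose only lift is itself and which is
  compatible with every genuine neighbour; so no lift of the first symbol can obstruct a lift of the
  second.\<close>

lemma right_eresolving_sqrt:
  "right_eresolving (sqrt_shift a X) (sqrt_shift a Y) (sqrt_code a X \<phi>)"
proof -
  let ?s = "symbol_map (sqrt_shift a X) (sqrt_code a X \<phi>)"
  have s_a: "?s a = a" if "a \<in> symbols (sqrt_shift a X)"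
    using symbol_map_sqrt [OF that] by simp
  have s_sym: "?s c = symbol_map X \<phi> c" "a \<in> symbols (sqrt_shift a X)" if "c \<in> symbols X" for c
  proof -
    have "c \<in> symbols (sqrt_shift a X)" and a: "a \<in> symbols (sqrt_shift a X)"
      using symbol_then_separator [OF that, of a]
      by (auto simp: mem_blocks_2_iff intro: symbolsI)
    then show "?s c = symbol_map X \<phi> c" "a \<in> symbols (sqrt_shift a X)"
      using symbol_map_sqrt a_X that by auto
  qed
  have "\<exists>a1. [a0, a1] \<in> blocks 2 (sqrt_shift a X) \<and> ?s a1 = b1"
    if a0: "a0 \<in> symbols (sqrt_shift a X)" and word: "[b0, b1] \<in> blocks 2 (sqrt_shift a Y)"
      and lift: "?s a0 = b0" for a0 b0 b1
  proof -
    consider "a0 = a" | "a0 \<in> symbols X"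
      using subsetD [OF symbols_sqrt_shift_subset a0] by auto
    then show ?thesis
    proof cases
      case 1
      then have "b0 = a" using lift s_a a0 by simp
      with word have "b1 \<in> symbols Y" using a_Y by (auto elim: blocks_2_sqrt_shift_cases)
      then obtain c where c: "c \<in> symbols X" "symbol_map X \<phi> c = b1" by (rule symbol_map_surj)
      then have "?s c = b1" by (simp add: s_sym(1))
      then show ?thesis using separator_then_symbol [OF c(1), of a] 1 by auto
    next
      case 2
      then have "b0 \<in> symbols Y" using lift s_sym(1) symbol_map_mem by metis
      with word have "b1 = a" using a_Y by (auto elim: blocks_2_sqrt_shift_cases)
      moreover have "?s a = a" using s_a s_sym(2) [OF 2] by simp
      ultimately show ?thesis using symbol_then_separator [OF 2, of a] by auto
    qed
  qed
  then show ?thesis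
    unfolding right_eresolving_def using one_block_code_sqrt sqrt_code_onto by blast
qed

text \<open>The shifted copy \<open>shift (eta a x)\<close> carries the separator at position \<open>0\<close>, whereas \<open>eta a y\<close>
  has a genuine symbol there; so the parity of a preimage is determined.\<close>

lemma sqrt_code_eq_eta_imp:
  assumes "z \<in> sqrt_shift a X" "sqrt_code a X \<phi> z = eta a y" "y \<in> Y"
  obtains x where "x \<in> X" "z = eta a x" "\<phi> x = y"
proof -
  obtain x where x: "x \<in> X" "z = eta a x \<or> z = shift (eta a x)"
    using assms(1) by (auto simp: sqrt_shift_def)
  have "z \<noteq> shift (eta a x)"
  proof
    assume "z = shift (eta a x)"
    then have "sqrt_code a X \<phi> z 0 = a" by (simp add: sqrt_code_def shift_def eta_def)
    moreover have "eta a y 0 = y 0" by (simp add: eta_def)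
    ultimately have "y 0 = a" using assms(2) by simp
    then show False using a_Y symbolsI [OF assms(3), of 0] by simp
  qed
  with x have z: "z = eta a x" by blast
  then have "\<phi> x = y" using assms(2) sqrt_code_eta [OF x(1)] inj_eta by metis
  with x(1) z show ?thesis by (rule that)
qed

lemma right_continuing_of_sqrt:
  assumes "right_continuing (sqrt_shift a X) (sqrt_shift a Y) (sqrt_code a X \<phi>)"
  shows "right_continuing X Y \<phi>"
proof -
  have "\<exists>x'\<in>X. left_asymptotic x' x \<and> \<phi> x' = y"
    if x: "x \<in> X" and y: "y \<in> Y" and las: "left_asymptotic (\<phi> x) y" for x y
  proof -
    have "eta a x \<in> sqrt_shift a X" "eta a y \<in> sqrt_shift a Y"
      using x y by (auto simp: sqrt_shift_def)
    moreover have "left_asymptotic (sqrt_code a X \<phi> (eta a x)) (eta a y)"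
      using las by (simp add: sqrt_code_eta x left_asymptotic_eta)
    ultimately obtain z where z: "z \<in> sqrt_shift a X" "left_asymptotic z (eta a x)"
        "sqrt_code a X \<phi> z = eta a y"
      using assms unfolding right_continuing_def by blast
    obtain x' where "x' \<in> X" "z = eta a x'" "\<phi> x' = y"
      using sqrt_code_eq_eta_imp [OF z(1,3) y] .
    moreover from this have "left_asymptotic x' x"
      using z(2) by (simp add: left_asymptotic_eta)
    ultimately show ?thesis by auto
  qed
  then show ?thesis
    using code onto by (auto simp: right_continuing_def one_block_code_def)
qed

end

section \<open>A one-block code that is not right continuing\<close>

definition vertex_shift :: "('s \<times> 's) set \<Rightarrow> (int \<Rightarrow> 's) set" where
  "vertex_shift E = {x. \<forall>i. (x i, x (i + 1)) \<in> E}"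

lemma shift_space_vertex_shift:
  assumes "finite E"
  shows "shift_space (vertex_shift E)"
proof (rule shift_spaceI)
  let ?T = "full_shift (fst ` E)" and ?D = "discrete_topology (fst ` E)"
  show "finite (fst ` E)" using assms by simp
  have proj: "continuous_map ?T ?D (\<lambda>x. x i)" for i
    unfolding full_shift_def by (auto intro: continuous_map_product_projection)
  have "closedin ?T {x \<in> topspace ?T. (x i, x (i + 1)) \<in> E \<inter> (fst ` E \<times> fst ` E)}" for i
  proof (rule closedin_continuous_map_preimage)
    show "continuous_map ?T (discrete_topology (fst ` E \<times> fst ` E)) (\<lambda>x. (x i, x (i + 1)))"
      unfolding prod_topology_discrete_topology
      using proj by (intro continuous_map_pairedI) auto
  qed auto
  then have "closedin ?T (\<Inter>i. {x \<in> topspace ?T. (x i, x (i + 1)) \<in> E \<inter> (fst ` E \<times> fst ` E)})"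
    by (intro closedin_Inter) auto
  moreover have "(\<Inter>i. {x \<in> topspace ?T. (x i, x (i + 1)) \<in> E \<inter> (fst ` E \<times> fst ` E)})
      = vertex_shift E"
    by (force simp: topspace_full_shift vertex_shift_def)
  ultimately show "closedin ?T (vertex_shift E)" by simp
  show "shift ` vertex_shift E = vertex_shift E"
  proof
    show "shift ` vertex_shift E \<subseteq> vertex_shift E" by (auto simp: shift_def vertex_shift_def)
    show "vertex_shift E \<subseteq> shift ` vertex_shift E"
    proof
      fix x assume x: "x \<in> vertex_shift E"
      have "(x (i - 1), x (i + 1 - 1)) \<in> E" for i
        using x [unfolded vertex_shift_def, simplified, rule_format, of "i - 1"] by simp
      then have "(\<lambda>i. x (i - 1)) \<in> vertex_shift E" by (simp add: vertex_shift_def)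
      moreover have "x = shift (\<lambda>i. x (i - 1))" by (simp add: shift_def)
      ultimately show "x \<in> shift ` vertex_shift E" by blast
    qed
  qed
qed

lemma ex_not_right_continuing:
  obtains X Y :: "(int \<Rightarrow> nat) set" and \<phi>
  where "one_block_code X Y \<phi>" "\<phi> ` X = Y" "3 \<notin> symbols X" "3 \<notin> symbols Y"
    "\<not> right_continuing X Y \<phi>"
proof -
  define E :: "(nat \<times> nat) set" where "E = {(0, 0), (2, 2), (2, 1), (1, 1)}"
  define F :: "(nat \<times> nat) set" where "F = {(0, 0), (0, 1), (1, 1)}"
  define X where "X = vertex_shift E"
  define Y where "Y = vertex_shift F"
  define \<phi> :: "(int \<Rightarrow> nat) \<Rightarrow> int \<Rightarrow> nat" where "\<phi> = (\<lambda>x i. (\<lambda>c. if c = 2 then 0 else c) (x i))"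
  have X_step: "(x i, x (i + 1)) \<in> E" if "x \<in> X" for x i
    using that by (simp add: X_def vertex_shift_def)
  have Y_step: "(y i, y (i + 1)) \<in> F" if "y \<in> Y" for y i
    using that by (simp add: Y_def vertex_shift_def)
  have maps: "\<phi> x \<in> Y" if "x \<in> X" for x
  proof -
    have "(\<phi> x i, \<phi> x (i + 1)) \<in> F" for i
      using X_step [OF that, of i] by (auto simp: E_def F_def \<phi>_def)
    then show ?thesis by (simp add: Y_def vertex_shift_def)
  qed
  have "y \<in> \<phi> ` X" if "y \<in> Y" for y
  proof -
    let ?x = "\<lambda>i. if y i = 0 then 2 else y i"
    have "(?x i, ?x (i + 1)) \<in> E" for i
      using Y_step [OF that, of i] by (auto simp: E_def F_def)
    then have x: "?x \<in> X" by (simp add: X_def vertex_shift_def)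
    have "y i \<noteq> 2" for i using Y_step [OF that, of i] by (auto simp: F_def)
    then have "y = \<phi> ?x" by (auto simp: \<phi>_def)
    then show ?thesis using x by (rule image_eqI)
  qed
  then have onto: "\<phi> ` X = Y" using maps by blast
  have "shift_space X" "shift_space Y"
    by (simp_all add: X_def Y_def E_def F_def shift_space_vertex_shift)
  then have "one_block_code X Y \<phi>"
    using maps unfolding \<phi>_def by (rule letter_map_one_block_code)
  moreover have "3 \<notin> symbols X"
  proof
    assume "3 \<in> symbols X"
    then obtain x i where "x \<in> X" "x i = 3" by (auto simp: mem_symbols_iff)
    then show False using X_step [of x i] by (simp add: E_def)
  qed
  moreover have "3 \<notin> symbols Y"
  proof
    assume "3 \<in> symbols Y"
    then obtain y i where "y \<in> Y" "y i = 3" by (auto simp: mem_symbols_iff)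
    then show False using Y_step [of y i] by (simp add: F_def)
  qed
  moreover have "\<not> right_continuing X Y \<phi>"
  proof
    assume rc: "right_continuing X Y \<phi>"
    let ?y = "\<lambda>i::int. if i \<le> 0 then 0 else 1 :: nat"
    have "(\<lambda>_. 0) \<in> X" by (simp add: X_def vertex_shift_def E_def)
    moreover have "?y \<in> Y" by (simp add: Y_def vertex_shift_def F_def)
    moreover have "left_asymptotic (\<phi> (\<lambda>_. 0)) ?y"
      by (auto simp: left_asymptotic_def \<phi>_def)
    ultimately obtain x where x: "x \<in> X" "left_asymptotic x (\<lambda>_. 0)" "\<phi> x = ?y"
      using rc unfolding right_continuing_def by blast
    then obtain n where n: "x n = 0" by (auto simp: left_asymptotic_def)
    \<comment> \<open>The only edge of \<open>E\<close> leaving \<open>0\<close> is its loop, so \<open>x\<close> stays at \<open>0\<close> from \<open>n\<close> on.\<close>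
    have "x i = 0" if "n \<le> i" for i
      using that
    proof (induction i rule: int_ge_induct)
      case (step i)
      then show ?case using X_step [OF x(1), of i] by (auto simp: E_def)
    qed (rule n)
    then have "\<phi> x (max n 1) = 0" by (simp add: \<phi>_def)
    moreover have "\<phi> x (max n 1) = 1" by (simp add: x(3))
    ultimately show False by simp
  qed
  ultimately show ?thesis using onto that by blast
qed

section \<open>Right eresolving codes need not be right continuing\<close>

theorem mainTheorem3:
  shows "(\<forall>(X :: (int \<Rightarrow> 's) set) (Y :: (int \<Rightarrow> 's) set) \<phi> a.
            one_block_code X Y \<phi> \<and> \<phi> ` X = Y \<and> a \<notin> symbols X \<and> a \<notin> symbols Y \<longrightarrow>
              one_block_code (sqrt_shift a X) (sqrt_shift a Y) (sqrt_code a X \<phi>) \<and>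
              sqrt_code a X \<phi> ` sqrt_shift a X = sqrt_shift a Y \<and>
              (\<forall>c \<in> symbols (sqrt_shift a X).
                 symbol_map (sqrt_shift a X) (sqrt_code a X \<phi>) c =
                   (if c = a then a else symbol_map X \<phi> c)) \<and>
              right_eresolving (sqrt_shift a X) (sqrt_shift a Y) (sqrt_code a X \<phi>) \<and>
              (\<not> right_continuing X Y \<phi> \<longrightarrow>
                 \<not> right_continuing (sqrt_shift a X) (sqrt_shift a Y) (sqrt_code a X \<phi>)))
       \<and> (\<exists>(X :: (int \<Rightarrow> nat) set) (Y :: (int \<Rightarrow> nat) set) \<phi>.
            shift_space X \<and> shift_space Y \<and>
            right_eresolving X Y \<phi> \<and> \<not> right_continuing X Y \<phi>)"
proof (intro conjI allI impI)
  show "\<exists>(X :: (int \<Rightarrow> nat) set) (Y :: (int \<Rightarrow> nat) set) \<phi>.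
      shift_space X \<and> shift_space Y \<and> right_eresolving X Y \<phi> \<and> \<not> right_continuing X Y \<phi>"
  proof -
    obtain X Y :: "(int \<Rightarrow> nat) set" and \<phi>
      where ex: "one_block_code X Y \<phi>" "\<phi> ` X = Y" "3 \<notin> symbols X" "3 \<notin> symbols Y"
        "\<not> right_continuing X Y \<phi>"
      by (rule ex_not_right_continuing)
    have "shift_space (sqrt_shift 3 X)" "shift_space (sqrt_shift 3 Y)"
      using shift_spaces [OF ex(1-4)] by (simp_all add: shift_space_sqrt_shift)
    then show ?thesis
      using right_eresolving_sqrt [OF ex(1-4)] right_continuing_of_sqrt [OF ex(1-4)] ex(5) by blast
  qed
next
  fix X Y :: "(int \<Rightarrow> 's) set" and \<phi> a
  assume "one_block_code X Y \<phi> \<and> \<phi> ` X = Y \<and> a \<notin> symbols X \<and> a \<notin> symbols Y"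
  then have h: "one_block_code X Y \<phi>" "\<phi> ` X = Y" "a \<notin> symbols X" "a \<notin> symbols Y" by auto
  show "one_block_code (sqrt_shift a X) (sqrt_shift a Y) (sqrt_code a X \<phi>)"
    by (rule one_block_code_sqrt [OF h])
  show "sqrt_code a X \<phi> ` sqrt_shift a X = sqrt_shift a Y"
    by (rule sqrt_code_onto [OF h])
  show "\<forall>c \<in> symbols (sqrt_shift a X).
      symbol_map (sqrt_shift a X) (sqrt_code a X \<phi>) c = (if c = a then a else symbol_map X \<phi> c)"
    by (rule ballI) (rule symbol_map_sqrt [OF h])
  show "right_eresolving (sqrt_shift a X) (sqrt_shift a Y) (sqrt_code a X \<phi>)"
    by (rule right_eresolving_sqrt [OF h])
  show "\<not> right_continuing (sqrt_shift a X) (sqrt_shift a Y) (sqrt_code a X \<phi>)"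
    if "\<not> right_continuing X Y \<phi>"
    using that right_continuing_of_sqrt [OF h] by blast
qed

end
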